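(* Let $V$ be a vector space over a division ring $D$. Then in $V$ we can define both a $D\star$-product $(a,m)\mapsto am$ and a $\star D$-product $(m,b)\mapsto mb$ of a vector over a scalar ($a,b\in D$, $m\in V$), and these operations satisfy the equation $$(am)b=a(mb)\qquad\text{for all }a,b\in D,\ m\in V.$$
   Context: $D$ is a division ring, not necessarily commutative. A vector space over $D$ is an abelian group $V$ with an effective representation of $D$ on it. A $D\star$-product is a product of vectors by scalars written on the left, given by an effective left-side representation $h$ of $D$ on the abelian group $V$ by $am=h(a)(m)$, so that $V$ is a left vector space ($D\star$-vector space). A $\star D$-product is a product of vectors by scalars written on the right, given by an effective right-side representation $f$ of $D$ on the abelian group $V$ by $mb=f(b)(m)$, so that $V$ is a right vector space ($\star D$-vector space). The two products are those of a pair of twin representations of $D$ on $V$, that is, representations $f$ and $h$ with $h(a)f(b)=f(b)h(a)$ for all $a,b\in D$. The displayed equation is called the associative law for twin representations, and it allows such expressions to be written without brackets. *)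

theory Defs
  imports Complex_Main
begin

text \<open>
  The library's \<open>module\<close> and \<open>vector_space\<close> locales require commutative scalars, so vector
  spaces over a noncommutative division ring are introduced here as representations in the
  endomorphisms of an abelian group. Both kinds of representation are curried functions with the
  scalar first: for a left-side representation \<open>h\<close> the product \<open>am\<close> is \<open>h a m\<close>, for a right-side
  representation \<open>f\<close> the product \<open>mb\<close> is \<open>f b m\<close>.
\<close>

definition left_side_representation ::
    "('d::division_ring \<Rightarrow> 'v::ab_group_add \<Rightarrow> 'v) \<Rightarrow> bool" where
  "left_side_representation h \<longleftrightarrow>
     (\<forall>a. additive (h a)) \<and>
     (\<forall>a b m. h (a + b) m = h a m + h b m) \<and>
     (\<forall>a b. h (a * b) = h a \<circ> h b) \<and>
     h 1 = id"

text \<open>On the right side the factors act in the opposite order: \<open>m(ab) = (ma)b\<close>.\<close>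

definition right_side_representation ::
    "('d::division_ring \<Rightarrow> 'v::ab_group_add \<Rightarrow> 'v) \<Rightarrow> bool" where
  "right_side_representation f \<longleftrightarrow>
     (\<forall>a. additive (f a)) \<and>
     (\<forall>a b m. f (a + b) m = f a m + f b m) \<and>
     (\<forall>a b. f (a * b) = f b \<circ> f a) \<and>
     f 1 = id"

text \<open>
  \<open>inj\<close> expresses that the representation is effective. Since \<open>0 \<noteq> 1\<close> in a division ring, it
  excludes the zero group.
\<close>

definition left_vector_space :: "('d::division_ring \<Rightarrow> 'v::ab_group_add \<Rightarrow> 'v) \<Rightarrow> bool" where
  "left_vector_space h \<longleftrightarrow> left_side_representation h \<and> inj h"

definition right_vector_space :: "('d::division_ring \<Rightarrow> 'v::ab_group_add \<Rightarrow> 'v) \<Rightarrow> bool" where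
  "right_vector_space f \<longleftrightarrow> right_side_representation f \<and> inj f"

definition twin_representations ::
    "('d::division_ring \<Rightarrow> 'v::ab_group_add \<Rightarrow> 'v) \<Rightarrow> ('d \<Rightarrow> 'v \<Rightarrow> 'v) \<Rightarrow> bool" where
  "twin_representations f h \<longleftrightarrow>
     right_side_representation f \<and> left_side_representation h \<and>
     (\<forall>a b. h a \<circ> f b = f b \<circ> h a)"

end

theory Submission
  imports Defs
begin

text \<open>
  A vector space over a division ring has a basis, and a basis identifies it with the finitely
  supported families of scalars. On such families the scalars act from both sides: multiplying all
  coordinates on the left by \<open>a\<close> is the given action, multiplying them all on the right by \<open>b\<close> is
  a new one, and the two commute because multiplication of scalars is associative. The second
  action depends on the choice of the basis: it is the one for which
  \<open>(\<Sum>v. c v v) b = \<Sum>v. (c v b) v\<close>.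

  A right vector space is a left vector space over the opposite division ring. The argument
  therefore takes the multiplication of scalars as a parameter, instantiated at the end by
  \<open>a * b\<close> for left vector spaces and by \<open>b * a\<close> for right ones. The substance is the existence of
  a maximal independent family (\<open>maximal_independent\<close>), the fact that it spans
  (\<open>maximal_independent_spans\<close>), and the resulting bijection between vectors and coordinates.
\<close>

section \<open>Scalars acting on an abelian group\<close>

text \<open>
  The scalars carry only an additive type class, so that one type can be used with a
  multiplication and with its opposite. Left inverses serve to normalise a coefficient to \<open>one\<close> and
  to cancel a nonzero left factor.
\<close>

locale division_ring_action =
  fixes mult :: "'d::ab_group_add \<Rightarrow> 'd \<Rightarrow> 'd" (infixl \<open>\<cdot>\<close> 70)
    and one :: 'd
    and act :: "'d \<Rightarrow> 'v::ab_group_add \<Rightarrow> 'v"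
  assumes mult_assoc: "a \<cdot> b \<cdot> c = a \<cdot> (b \<cdot> c)"
    and mult_one: "a \<cdot> one = a"
    and distrib_left: "a \<cdot> (b + c) = a \<cdot> b + a \<cdot> c"
    and distrib_right: "(a + b) \<cdot> c = a \<cdot> c + b \<cdot> c"
    and left_inverse: "a \<noteq> 0 \<Longrightarrow> \<exists>b. b \<cdot> a = one"
    and one_mult: "one \<cdot> a = a"
    and act_add: "act a (m + n) = act a m + act a n"
    and add_act: "act (a + b) m = act a m + act b m"
    and mult_act: "act (a \<cdot> b) m = act a (act b m)"
    and one_act: "act one m = m"
begin

lemma mult_zero [simp]: "a \<cdot> 0 = 0"
  using distrib_left[of a 0 0] by simp

lemma zero_mult [simp]: "0 \<cdot> a = 0"
  using distrib_right[of 0 0 a] by simp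

lemma act_zero [simp]: "act a 0 = 0"
  using act_add[of a 0 0] by simp

lemma zero_act [simp]: "act 0 m = 0"
  using add_act[of 0 0 m] by simp

lemma mult_left_cancel:
  assumes "a \<noteq> 0" "a \<cdot> b = a \<cdot> c"
  shows "b = c"
proof -
  obtain a' where "a' \<cdot> a = one" using left_inverse assms(1) by blast
  then show ?thesis using assms(2) mult_assoc one_mult by metis
qed

lemma act_sum: "act a (sum g S) = (\<Sum>i\<in>S. act a (g i))"
  by (induction S rule: infinite_finite_induct) (simp_all add: act_add)

section \<open>Linear combinations and independence\<close>

definition support :: "('v \<Rightarrow> 'd) \<Rightarrow> 'v set" where
  "support c = {v. c v \<noteq> 0}"

definition families :: "'v set \<Rightarrow> ('v \<Rightarrow> 'd) set" where
  "families B = {c. finite (support c) \<and> support c \<subseteq> B}"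

definition combination :: "('v \<Rightarrow> 'd) \<Rightarrow> 'v" where
  "combination c = (\<Sum>v\<in>support c. act (c v) v)"

definition independent :: "'v set \<Rightarrow> bool" where
  "independent B \<longleftrightarrow> (\<forall>c\<in>families B. combination c = 0 \<longrightarrow> c = (\<lambda>_. 0))"

lemma families_mono: "B \<subseteq> C \<Longrightarrow> families B \<subseteq> families C"
  by (auto simp: families_def)

lemma families_add:
  assumes "c \<in> families B" "d \<in> families B"
  shows "(\<lambda>v. c v + d v) \<in> families B"
proof -
  have "support (\<lambda>v. c v + d v) \<subseteq> support c \<union> support d"
    by (auto simp: support_def)
  with assms show ?thesis
    unfolding families_def by (blast intro: finite_subset finite_UnI)
qed

lemma families_map:
  assumes "c \<in> families B" "\<phi> 0 = 0"
  shows "(\<lambda>v. \<phi> (c v)) \<in> families B"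
proof -
  have "support (\<lambda>v. \<phi> (c v)) \<subseteq> support c"
    using assms(2) by (auto simp: support_def)
  with assms(1) show ?thesis
    unfolding families_def by (blast intro: finite_subset)
qed

lemma combination_superset:
  assumes "finite S" "support c \<subseteq> S"
  shows "combination c = (\<Sum>v\<in>S. act (c v) v)"
  unfolding combination_def
  by (rule sum.mono_neutral_left) (use assms in \<open>auto simp: support_def\<close>)

lemma combination_add:
  assumes "c \<in> families B" "d \<in> families B"
  shows "combination (\<lambda>v. c v + d v) = combination c + combination d"
proof -
  let ?S = "support c \<union> support d"
  have "finite ?S" using assms by (simp add: families_def)
  moreover have "support (\<lambda>v. c v + d v) \<subseteq> ?S" by (auto simp: support_def)
  ultimately show ?thesis
    by (simp add: combination_superset[of ?S] add_act sum.distrib)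
qed

lemma combination_scale:
  assumes "c \<in> families B"
  shows "combination (\<lambda>v. a \<cdot> c v) = act a (combination c)"
proof -
  have "finite (support c)" using assms by (simp add: families_def)
  moreover have "support (\<lambda>v. a \<cdot> c v) \<subseteq> support c" by (auto simp: support_def)
  ultimately show ?thesis
    by (simp add: combination_superset[of "support c"] act_sum mult_act)
qed

lemma combination_single: "combination (\<lambda>v. if v = m then a else 0) = act a m"
  by (subst combination_superset[of "{m}"]) (auto simp: support_def)

lemma single_in_families: "m \<in> B \<Longrightarrow> (\<lambda>v. if v = m then a else 0) \<in> families B"
  by (auto simp: families_def support_def intro: finite_subset[of _ "{m}"])

lemma act_minus: "act (- a) m = - act a m"
  using add_act[of a "- a" m] by (simp add: eq_neg_iff_add_eq_0 add.commute)

lemma combination_uminus: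
  "c \<in> families B \<Longrightarrow> combination (\<lambda>v. - c v) = - combination c"
  by (simp add: combination_def support_def act_minus sum_negf)

section \<open>Existence of a basis\<close>

text \<open>
  A dependence relation involves only finitely many vectors, so in the union of a chain of sets
  it already lives in a single member. Hence Zorn's lemma applies to independent sets.
\<close>

lemma maximal_independent:
  "\<exists>B. independent B \<and> (\<forall>C. independent C \<longrightarrow> B \<subseteq> C \<longrightarrow> C = B)"
proof -
  have "\<exists>B\<in>Collect independent. \<forall>C\<in>Collect independent. B \<subseteq> C \<longrightarrow> C = B"
  proof (rule subset_Zorn_nonempty)
    have "independent {}" by (auto simp: independent_def families_def support_def)
    then show "Collect independent \<noteq> {}" by blast
  next
    fix \<C> assume ne: "\<C> \<noteq> {}" and ch: "subset.chain (Collect independent) \<C>"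
    have "c = (\<lambda>_. 0)" if c: "c \<in> families (\<Union>\<C>)" and 0: "combination c = 0" for c
    proof -
      have "finite (support c)" "support c \<subseteq> \<Union>\<C>" using c by (auto simp: families_def)
      then obtain X where "X \<in> \<C>" "support c \<subseteq> X"
        using finite_subset_Union_chain[OF _ _ ne ch] by blast
      then have "c \<in> families X" "independent X"
        using c ch by (auto simp: families_def subset.chain_def)
      then show ?thesis using 0 by (auto simp: independent_def)
    qed
    then show "\<Union>\<C> \<in> Collect independent" by (auto simp: independent_def)
  qed
  then show ?thesis by blast
qed

text \<open>
  By maximality, a vector \<open>m\<close> outside the set occurs in a dependence relation together with
  elements of the set, and its coefficient there cannot vanish. Dividing by that coefficient on
  the left solves the relation for \<open>m\<close>.
\<close>

lemma maximal_independent_spans: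
  assumes ind: "independent B"
    and max: "\<And>C. independent C \<Longrightarrow> B \<subseteq> C \<Longrightarrow> C = B"
  shows "\<exists>c\<in>families B. combination c = m"
proof (cases "m \<in> B")
  case True
  then show ?thesis
    using single_in_families[of m B one] combination_single[of m one]
    by (auto simp: one_act)
next
  case False
  then have "\<not> independent (insert m B)" using max[of "insert m B"] by blast
  then obtain c where c: "c \<in> families (insert m B)" "combination c = 0" "c \<noteq> (\<lambda>_. 0)"
    by (auto simp: independent_def)
  have "c m \<noteq> 0"
  proof
    assume "c m = 0"
    then have "c \<in> families B" using c(1) by (auto simp: families_def support_def)
    then show False using ind c by (auto simp: independent_def)
  qed
  then obtain b where b: "b \<cdot> c m = one" using left_inverse by blast
  define e where "e = (\<lambda>v. b \<cdot> c v)"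
  define d where "d = (\<lambda>v. if v = m then 0 else - e v)"
  have e: "e \<in> families (insert m B)" "combination e = 0"
    using families_map[OF c(1), of "\<lambda>x. b \<cdot> x"] combination_scale[OF c(1), of b] c(2)
    by (simp_all add: e_def)
  have "support d \<subseteq> support e - {m}" by (auto simp: d_def support_def)
  then have d: "d \<in> families B"
    using e(1) unfolding families_def by (blast intro: finite_subset)
  \<comment> \<open>Adding \<open>d\<close> removes every term of the normalised relation \<open>e\<close> except the one at \<open>m\<close>.\<close>
  have "combination d = combination (\<lambda>v. e v + d v)"
    using combination_add[OF e(1), of d] d families_mono[of B "insert m B"] e(2)
    by (auto simp: subset_iff)
  also have "(\<lambda>v. e v + d v) = (\<lambda>v. if v = m then one else 0)"
    by (auto simp: d_def e_def b)
  finally have "combination d = m" by (simp add: combination_single one_act)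
  then show ?thesis using d by blast
qed

lemma independent_combination_inj:
  assumes ind: "independent B" and c: "c \<in> families B" and d: "d \<in> families B"
    and eq: "combination c = combination d"
  shows "c = d"
proof -
  have md: "(\<lambda>v. - d v) \<in> families B" using families_map[OF d, of uminus] by simp
  have "combination (\<lambda>v. c v + - d v) = 0"
    using combination_add[OF c md] combination_uminus[OF d] eq by simp
  then have "(\<lambda>v. c v + - d v) = (\<lambda>_. 0)"
    using ind families_add[OF c md] unfolding independent_def by blast
  then show ?thesis by (simp add: fun_eq_iff)
qed

section \<open>The action on the other side\<close>

text \<open>
  Right multiplication of coordinates by \<open>b\<close> respects sums and left multiples, and it composes in
  the order opposite to \<open>act\<close>. Effectiveness asks for a nonzero vector: one of its coordinates is
  a nonzero scalar, which can be cancelled.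
\<close>

theorem ex_commuting_action:
  "\<exists>f. (\<forall>b m n. f b (m + n) = f b m + f b n) \<and>
       (\<forall>a b m. f (a + b) m = f a m + f b m) \<and>
       (\<forall>a b m. f (a \<cdot> b) m = f b (f a m)) \<and>
       (\<forall>m. f one m = m) \<and>
       (\<forall>a b m. f b (act a m) = act a (f b m)) \<and>
       ((\<exists>m::'v. m \<noteq> 0) \<longrightarrow> inj f)"
proof -
  obtain B where B: "independent B" "\<And>C. independent C \<Longrightarrow> B \<subseteq> C \<Longrightarrow> C = B"
    using maximal_independent by blast
  obtain coord where coord: "\<And>m. coord m \<in> families B" "\<And>m. combination (coord m) = m"
    using maximal_independent_spans[OF B] by metis
  have coord_eq: "coord m = c" if "c \<in> families B" "combination c = m" for c m
    using independent_combination_inj[OF B(1) coord(1) that(1)] coord(2) that(2) by simp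
  have coord_add: "coord (m + n) = (\<lambda>v. coord m v + coord n v)" for m n
    by (rule coord_eq[OF families_add[OF coord(1) coord(1)]])
      (simp add: combination_add[OF coord(1) coord(1)] coord(2))
  have coord_act: "coord (act a m) = (\<lambda>v. a \<cdot> coord m v)" for a m
    by (rule coord_eq[OF families_map[OF coord(1)]])
      (simp_all add: combination_scale[OF coord(1)] coord(2))
  define f where "f b m = combination (\<lambda>v. coord m v \<cdot> b)" for b m
  have right: "(\<lambda>v. coord m v \<cdot> b) \<in> families B" for b m
    by (rule families_map[OF coord(1)]) simp
  have coord_f: "coord (f b m) = (\<lambda>v. coord m v \<cdot> b)" for b m
    by (rule coord_eq[OF right]) (simp add: f_def)
  have "f b (m + n) = f b m + f b n" for b m n
    using combination_add[OF right right] by (simp add: f_def coord_add distrib_right)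
  moreover have "f (a + b) m = f a m + f b m" for a b m
    using combination_add[OF right right] by (simp add: f_def distrib_left)
  moreover have "f (a \<cdot> b) m = f b (f a m)" for a b m
    unfolding f_def[of b] f_def[of "a \<cdot> b"] coord_f by (simp add: mult_assoc)
  moreover have "f one m = m" for m
    by (simp add: f_def mult_one coord(2))
  moreover have "f b (act a m) = act a (f b m)" for a b m
    using combination_scale[OF right] by (simp add: f_def coord_act mult_assoc)
  moreover have "inj f" if "m \<noteq> 0" for m :: 'v
  proof (rule injI)
    fix a b assume eq: "f a = f b"
    have "\<exists>v. coord m v \<noteq> 0"
    proof (rule ccontr)
      assume "\<nexists>v. coord m v \<noteq> 0"
      then have "combination (coord m) = 0" by (simp add: combination_def support_def)
      then show False using coord(2) that by simp
    qed
    then obtain v where v: "coord m v \<noteq> 0" by blast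
    have "coord m v \<cdot> a = coord m v \<cdot> b"
      using fun_cong[OF coord_f[of a m], of v] fun_cong[OF coord_f[of b m], of v] eq by simp
    then show "a = b" using mult_left_cancel v by blast
  qed
  ultimately show ?thesis by (intro exI[of _ f]) blast
qed

end

section \<open>Left and right vector spaces\<close>

lemma effective_imp_nonzero:
  fixes g :: "'d::division_ring \<Rightarrow> 'v::ab_group_add \<Rightarrow> 'v"
  assumes "inj g"
  shows "\<exists>m::'v. m \<noteq> 0"
proof (rule ccontr)
  assume "\<not> (\<exists>m::'v. m \<noteq> 0)"
  then have "m = n" for m n :: 'v by (metis (full_types))
  then have "g 0 = g 1" by (rule ext)
  then show False using injD[OF assms] zero_neq_one by blast
qed

theorem theorem2p3p3:
  fixes g :: "'d::division_ring \<Rightarrow> 'v::ab_group_add \<Rightarrow> 'v"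
  shows "(left_vector_space g \<longrightarrow>
            (\<exists>f. right_vector_space f \<and> twin_representations f g \<and>
                 (\<forall>a b m. f b (g a m) = g a (f b m)))) \<and>
         (right_vector_space g \<longrightarrow>
            (\<exists>h. left_vector_space h \<and> twin_representations g h \<and>
                 (\<forall>a b m. g b (h a m) = h a (g b m))))"
proof (intro conjI impI)
  assume g: "left_vector_space g"
  then have rep: "left_side_representation g" and inj: "inj g"
    by (auto simp: left_vector_space_def)
  have inverse: "\<exists>b. b * a = 1" if "a \<noteq> 0" for a :: 'd
    using left_inverse[OF that] by blast
  interpret division_ring_action "(*)" 1 g
    by unfold_locales
      (use rep inverse in \<open>auto simp: left_side_representation_def additive_def
        distrib_left distrib_right mult.assoc\<close>)
  obtain f :: "'d \<Rightarrow> 'v \<Rightarrow> 'v" where f: "\<And>b m n. f b (m + n) = f b m + f b n"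
      "\<And>a b m. f (a + b) m = f a m + f b m"
      "\<And>a b m. f (a * b) m = f b (f a m)"
      "\<And>m. f 1 m = m"
      "\<And>a b m. f b (g a m) = g a (f b m)"
      "inj f"
    using ex_commuting_action effective_imp_nonzero[OF inj] by blast
  have "right_side_representation f"
    using f by (auto simp: right_side_representation_def additive_def fun_eq_iff)
  then show "\<exists>f. right_vector_space f \<and> twin_representations f g \<and>
      (\<forall>a b m. f b (g a m) = g a (f b m))"
    using f rep
    by (intro exI[of _ f]) (auto simp: right_vector_space_def twin_representations_def fun_eq_iff)
next
  assume g: "right_vector_space g"
  then have rep: "right_side_representation g" and inj: "inj g"
    by (auto simp: right_vector_space_def)
  have inverse: "\<exists>b. a * b = 1" if "a \<noteq> 0" for a :: 'd
    using right_inverse[OF that] by blast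
  interpret division_ring_action "\<lambda>a b. b * a" 1 g
    by unfold_locales
      (use rep inverse in \<open>auto simp: right_side_representation_def additive_def
        distrib_left distrib_right mult.assoc\<close>)
  obtain h :: "'d \<Rightarrow> 'v \<Rightarrow> 'v" where h: "\<And>a m n. h a (m + n) = h a m + h a n"
      "\<And>a b m. h (a + b) m = h a m + h b m"
      "\<And>a b m. h (b * a) m = h b (h a m)"
      "\<And>m. h 1 m = m"
      "\<And>a b m. h a (g b m) = g b (h a m)"
      "inj h"
    using ex_commuting_action effective_imp_nonzero[OF inj] by blast
  have "left_side_representation h"
    using h by (auto simp: left_side_representation_def additive_def fun_eq_iff)
  then show "\<exists>h. left_vector_space h \<and> twin_representations g h \<and>
      (\<forall>a b m. g b (h a m) = h a (g b m))"
    using h rep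
    by (intro exI[of _ h]) (auto simp: left_vector_space_def twin_representations_def fun_eq_iff)
qed

end
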